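(* Let $m\in\mathbb{R}\setminus\{0,-1\}$ and let $\mathbf{x}=(x_1,x_2,x_3,x_4)$ be a strictly planar relative equilibrium of the four-vortex problem with vorticities $\Gamma_1=\Gamma_2=1$ and $\Gamma_3=\Gamma_4=m$. (1) If $m>0$ and $\mathbf{x}$ is convex, then $\mathbf{x}$ has a line of symmetry. If $m>0$, the only possible strictly planar asymmetric configurations are concave with the two vortices of smaller strength lying on the exterior triangle. If $m=1$, all solutions contain a line of symmetry. (2) If $m<0$ and $\mathbf{x}$ is concave, then $\mathbf{x}$ has a line of symmetry. If $m<0$, the only possible strictly planar asymmetric configurations are convex with equal-strength vortices necessarily adjacent.
   Context: Four point vortices have distinct positions $x_i\in\mathbb{R}^2$ and strengths (vorticities) $\Gamma_i\in\mathbb{R}\setminus\{0\}$; $r_{ij}=\|x_i-x_j\|$. The configuration is a relative equilibrium (central configuration) if there are $\lambda\in\mathbb{R}\setminus\{0\}$ and $c\in\mathbb{R}^2$ with $-\lambda(x_i-c)=\sum_{j\ne i}\frac{\Gamma_j}{r_{ij}^2}(x_j-x_i)$ for $i=1,\dots,4$. Strictly planar means that the four vortices are not collinear. A configuration with no three collinear vortices is concave if one vortex lies strictly inside the convex hull (the exterior triangle) of the other three, and convex if no vortex lies in the convex hull of the other three; in the convex case two vortices are adjacent if they are joined by a side (not a diagonal) of the quadrilateral. Asymmetric means having no line of symmetry (as a configuration of four points in the plane). *)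

theory Defs
  imports "HOL-Analysis.Analysis"
begin

text \<open>Four vortices are indexed by the four-element type \<open>4\<close>, whose elements are
  \<open>1\<close>, \<open>2\<close>, \<open>3\<close> and \<open>4 = 0\<close>.\<close>

type_synonym configuration = "4 \<Rightarrow> real ^ 2"

definition relative_equilibrium :: "(4 \<Rightarrow> real) \<Rightarrow> configuration \<Rightarrow> bool" where
  "relative_equilibrium \<Gamma> x \<longleftrightarrow>
     inj x \<and> (\<forall>i. \<Gamma> i \<noteq> 0) \<and>
     (\<exists>(l::real) (c::real ^ 2). l \<noteq> 0 \<and>
        (\<forall>i. - (l *\<^sub>R (x i - c)) =
              (\<Sum>j\<in>UNIV - {i}. (\<Gamma> j / (dist (x i) (x j))\<^sup>2) *\<^sub>R (x j - x i))))"

definition strictly_planar :: "configuration \<Rightarrow> bool" where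
  "strictly_planar x \<longleftrightarrow> \<not> collinear (range x)"

definition no_three_collinear :: "configuration \<Rightarrow> bool" where
  "no_three_collinear x \<longleftrightarrow>
     (\<forall>i j k. i \<noteq> j \<longrightarrow> j \<noteq> k \<longrightarrow> i \<noteq> k \<longrightarrow> \<not> collinear {x i, x j, x k})"

definition interior_vortex :: "configuration \<Rightarrow> 4 \<Rightarrow> bool" where
  "interior_vortex x k \<longleftrightarrow> x k \<in> interior (convex hull (x ` (UNIV - {k})))"

definition concave_config :: "configuration \<Rightarrow> bool" where
  "concave_config x \<longleftrightarrow> no_three_collinear x \<and> (\<exists>k. interior_vortex x k)"

definition convex_config :: "configuration \<Rightarrow> bool" where
  "convex_config x \<longleftrightarrow>
     no_three_collinear x \<and> (\<forall>k. x k \<notin> convex hull (x ` (UNIV - {k})))"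

text \<open>Used for concave configurations: vortex \<open>i\<close> is a vertex of the triangle formed by the
  three vortices other than an interior one.\<close>

definition on_exterior_triangle :: "configuration \<Rightarrow> 4 \<Rightarrow> bool" where
  "on_exterior_triangle x i \<longleftrightarrow> (\<exists>k. interior_vortex x k \<and> i \<noteq> k)"

text \<open>Used for convex configurations: the convex hull of the four points is then the
  quadrilateral, and its one-dimensional faces are its sides (the diagonals are not faces).\<close>

definition adjacent :: "configuration \<Rightarrow> 4 \<Rightarrow> 4 \<Rightarrow> bool" where
  "adjacent x i j \<longleftrightarrow> closed_segment (x i) (x j) edge_of (convex hull (range x))"

text \<open>For a unit vector \<open>n\<close>, this is the reflection in the line through \<open>a\<close> normal to \<open>n\<close>.\<close>

definition reflect_line :: "real ^ 2 \<Rightarrow> real ^ 2 \<Rightarrow> real ^ 2 \<Rightarrow> real ^ 2" where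
  "reflect_line a n p = p - (2 * ((p - a) \<bullet> n)) *\<^sub>R n"

text \<open>Symmetry of the set of four points; the reflection is not required to match strengths.\<close>

definition has_line_of_symmetry :: "configuration \<Rightarrow> bool" where
  "has_line_of_symmetry x \<longleftrightarrow>
     (\<exists>a n. norm n = 1 \<and> reflect_line a n ` range x = range x)"

definition asymmetric :: "configuration \<Rightarrow> bool" where
  "asymmetric x \<longleftrightarrow> \<not> has_line_of_symmetry x"

end

theory Submission
  imports Defs
begin

text \<open>Four points of the plane that are not collinear satisfy, up to a factor, exactly one affine
dependency \<open>\<Sum>i. \<Delta> i = 0\<close>, \<open>\<Sum>i. \<Delta> i *\<^sub>R x i = 0\<close> (lemma \<open>dependency_space_1_dim\<close>); its
coefficients are signed areas of the four triangles. When none of them vanishes, their signs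
describe the position of the points: a coefficient whose sign differs from that of the three
others belongs to an interior point, and two coefficients of each sign mean a convex
quadrilateral whose diagonals join the points of equal sign.

For a relative equilibrium with total strength \<open>G \<noteq> 0\<close> put \<open>w = \<lambda> / G\<close>. The equation of vortex \<open>i\<close>
says that the numbers \<open>\<Gamma> j * (1 / r\<^sub>i\<^sub>j\<^sup>2 - w)\<close> form an affine dependency once the
coefficient at \<open>i\<close> is chosen to make the sum zero. All these dependencies being proportional to
\<open>\<Delta>\<close>, there is a number \<open>\<sigma>\<close> with \<open>1 / r\<^sub>i\<^sub>j\<^sup>2 = w + \<sigma> * u i * u j\<close> for
\<open>u i = \<Delta> i / \<Gamma> i\<close> (lemma \<open>vortex_parametrisation\<close>). So either of \<open>u 1 = u 2\<close> and \<open>u 3 = u 4\<close>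
makes the configuration a kite, and \<open>u 1 + u 2 = u 3 + u 4 = 0\<close> makes it an isosceles trapezoid.

In the remaining case put \<open>\<tau> = \<sigma> / w\<close>, \<open>p = \<tau> * u 1 * u 2\<close>, \<open>q = \<tau> * u 3 * u 4\<close> and
\<open>B = \<tau> * (u 3 + u 4)\<^sup>2\<close>. The sum \<open>\<Sum>j. \<Delta> j * r\<^sub>i\<^sub>j\<^sup>2\<close> does not depend on \<open>i\<close>. Comparing
its values for the two vortices of an equal pair and dividing by \<open>u 1 - u 2\<close> or \<open>u 3 - u 4\<close> gives
two equations linear in \<open>B\<close> (lemma \<open>pair_balance\<close>), and a third one comes from the weighted sum of
all four values (lemma \<open>inertia_balance\<close>). Eliminating \<open>B\<close> and one further unknown leaves a
polynomial that splits into simple factors. Most of them would force an infinite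
distance or \<open>B = 0\<close>; what remains is \<open>p = m\<close> or \<open>q = 1 / m\<close> (lemma \<open>elimination_branches\<close>), and then
\<open>p\<close>, \<open>q\<close>, \<open>B\<close> are explicit functions of \<open>m\<close>. Finally \<open>B = \<tau> * (u 3 + u 4)\<^sup>2\<close> and
\<open>B - 4 * q = \<tau> * (u 3 - u 4)\<^sup>2\<close> have the same sign, and likewise for the other pair; this
restricts the first branch to \<open>\<bar>m\<bar> < 1\<close> and the second to \<open>\<bar>m\<bar> > 1\<close>, and fixes
the signs of \<open>u 1 * u 2\<close> and \<open>u 3 * u 4\<close> (lemma \<open>asymmetric_sign_patterns\<close>). These signs are the
claims of the theorem.\<close>

section \<open>Affine dependencies of four planar points\<close>

definition affine_dependency :: "configuration \<Rightarrow> (4 \<Rightarrow> real) \<Rightarrow> bool" where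
  "affine_dependency x c \<longleftrightarrow> sum c UNIV = 0 \<and> (\<Sum>i\<in>UNIV. c i *\<^sub>R x i) = 0"

lemma affine_dependency_iff:
  "affine_dependency x c \<longleftrightarrow> c 1 + c 2 + c 3 + c 4 = 0
     \<and> c 1 * x 1 $ 1 + c 2 * x 2 $ 1 + c 3 * x 3 $ 1 + c 4 * x 4 $ 1 = 0
     \<and> c 1 * x 1 $ 2 + c 2 * x 2 $ 2 + c 3 * x 3 $ 2 + c 4 * x 4 $ 2 = 0"
  by (simp add: affine_dependency_def sum_4 vec_eq_iff forall_2)

text \<open>Twice the signed area of the triangle \<open>a b c\<close>.\<close>

definition cross_area :: "real ^ 2 \<Rightarrow> real ^ 2 \<Rightarrow> real ^ 2 \<Rightarrow> real" where
  "cross_area a b c = (b $ 1 - a $ 1) * (c $ 2 - a $ 2) - (b $ 2 - a $ 2) * (c $ 1 - a $ 1)"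

lemma cross_area_0 [simp]: "cross_area a a b = 0" "cross_area a b b = 0" "cross_area a b a = 0"
  by (simp_all add: cross_area_def)

lemma cross_area_swap: "cross_area b a c = - cross_area a b c" "cross_area a c b = - cross_area a b c"
  by (simp_all add: cross_area_def algebra_simps)

lemma collinear_if_cross_area_0:
  assumes "cross_area a b c = 0"
  shows "collinear {a, b, c}"
proof (cases "a = c")
  case True
  then show ?thesis by (simp add: insert_commute)
next
  case False
  define v1 where "v1 = c $ 1 - a $ 1"
  define v2 where "v2 = c $ 2 - a $ 2"
  define w1 where "w1 = b $ 1 - a $ 1"
  define w2 where "w2 = b $ 2 - a $ 2"
  have eq: "w1 * v2 = w2 * v1"
    using assms by (simp add: cross_area_def v1_def v2_def w1_def w2_def)
  define n where "n = v1\<^sup>2 + v2\<^sup>2"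
  have "n \<noteq> 0"
    using False unfolding n_def v1_def v2_def
    by (auto simp: vec_eq_iff forall_2 sum_power2_eq_zero_iff)
  define t where "t = (w1 * v1 + w2 * v2) / n"
  have "t * n = w1 * v1 + w2 * v2" using \<open>n \<noteq> 0\<close> by (simp add: t_def)
  then have "n * (t * v1) = n * w1" "n * (t * v2) = n * w2"
    using eq unfolding n_def by algebra+
  then have "t * v1 = w1" "t * v2 = w2" using \<open>n \<noteq> 0\<close> by simp_all
  then have "b = (1 - t) *\<^sub>R a + (1 - (1 - t)) *\<^sub>R c"
    by (simp add: vec_eq_iff forall_2 v1_def v2_def w1_def w2_def algebra_simps)
  then show ?thesis unfolding collinear_3_expand by blast
qed

text \<open>For fixed \<open>P\<close> and \<open>Q\<close> the area is an affine function of its first argument, and a dependency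
annihilates all affine functions. Taking two of the four points for \<open>P\<close> and \<open>Q\<close> leaves a relation
between the two other coefficients.\<close>

lemma affine_dependency_cross_area:
  assumes "affine_dependency x c"
  shows "c 1 * cross_area (x 1) P Q + c 2 * cross_area (x 2) P Q + c 3 * cross_area (x 3) P Q
    + c 4 * cross_area (x 4) P Q = 0"
proof -
  have c: "cross_area z P Q = z $ 1 * (P $ 2 - Q $ 2) - z $ 2 * (P $ 1 - Q $ 1) + (P $ 1 * Q $ 2 - P $ 2 * Q $ 1)" for z
    by (simp add: cross_area_def algebra_simps)
  have "c 1 * cross_area (x 1) P Q + c 2 * cross_area (x 2) P Q + c 3 * cross_area (x 3) P Q
    + c 4 * cross_area (x 4) P Q
    = (c 1 * x 1 $ 1 + c 2 * x 2 $ 1 + c 3 * x 3 $ 1 + c 4 * x 4 $ 1) * (P $ 2 - Q $ 2)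
    - (c 1 * x 1 $ 2 + c 2 * x 2 $ 2 + c 3 * x 3 $ 2 + c 4 * x 4 $ 2) * (P $ 1 - Q $ 1)
    + (c 1 + c 2 + c 3 + c 4) * (P $ 1 * Q $ 2 - P $ 2 * Q $ 1)"
    unfolding c by (simp add: algebra_simps)
  then show ?thesis using assms by (simp add: affine_dependency_iff)
qed

text \<open>The witness \<open>\<Delta>\<close> consists of the alternating signed areas of the triangles omitting one point.\<close>

lemma dependency_space_1_dim:
  assumes "strictly_planar x" "inj x"
  obtains \<Delta> where "affine_dependency x \<Delta>" "\<exists>i. \<Delta> i \<noteq> 0"
    and "\<And>c. affine_dependency x c \<Longrightarrow> \<exists>k. \<forall>i. c i = k * \<Delta> i"
proof -
  define \<Delta> :: "4 \<Rightarrow> real" where "\<Delta> i =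
    (if i = 1 then cross_area (x 2) (x 3) (x 4) else if i = 2 then - cross_area (x 1) (x 3) (x 4)
     else if i = 3 then cross_area (x 1) (x 2) (x 4) else - cross_area (x 1) (x 2) (x 3))" for i
  have \<Delta>: "\<Delta> 1 = cross_area (x 2) (x 3) (x 4)" "\<Delta> 2 = - cross_area (x 1) (x 3) (x 4)"
    "\<Delta> 3 = cross_area (x 1) (x 2) (x 4)" "\<Delta> 4 = - cross_area (x 1) (x 2) (x 3)"
    by (simp_all add: \<Delta>_def)
  have dep: "affine_dependency x \<Delta>"
    unfolding affine_dependency_iff \<Delta> cross_area_def by algebra
  have nz: "\<exists>i. \<Delta> i \<noteq> 0"
  proof (rule ccontr)
    assume "\<not> ?thesis"
    then have "\<Delta> 3 = 0" "\<Delta> 4 = 0" by auto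
    then have "collinear {x 1, x 2, x 4}" "collinear {x 1, x 2, x 3}"
      using collinear_if_cross_area_0 unfolding \<Delta> by simp_all
    moreover have "x 1 \<noteq> x 2" using \<open>inj x\<close> by (simp add: inj_eq)
    ultimately have "collinear {x 1, x 2, x 3, x 4}"
      by (subst collinear_triples) auto
    then show False using assms(1) by (simp add: strictly_planar_def UNIV_4)
  qed
  have "\<forall>i j. c i * \<Delta> j = c j * \<Delta> i" if "affine_dependency x c" for c
  proof -
    note F = affine_dependency_cross_area[OF that]
    have "c 1 * \<Delta> 2 = c 2 * \<Delta> 1" using F[of "x 3" "x 4"] by (simp add: \<Delta>)
    moreover have "c 1 * \<Delta> 3 = c 3 * \<Delta> 1"
      using F[of "x 2" "x 4"] by (simp add: \<Delta> cross_area_swap[of "x 3" "x 2"])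
    moreover have "c 1 * \<Delta> 4 = c 4 * \<Delta> 1"
      using F[of "x 2" "x 3"] by (simp add: \<Delta> cross_area_swap(1)[of "x 4" "x 2"] cross_area_swap(2)[of "x 2" "x 4"])
    moreover have "c 2 * \<Delta> 3 = c 3 * \<Delta> 2"
      using F[of "x 1" "x 4"] by (simp add: \<Delta> cross_area_swap[of _ "x 1"])
    moreover have "c 2 * \<Delta> 4 = c 4 * \<Delta> 2"
      using F[of "x 1" "x 3"] by (simp add: \<Delta> cross_area_swap(1)[of _ "x 1"] cross_area_swap(2)[of "x 1" "x 4"])
    moreover have "c 3 * \<Delta> 4 = c 4 * \<Delta> 3"
      using F[of "x 1" "x 2"] by (simp add: \<Delta> cross_area_swap(1)[of _ "x 1"] cross_area_swap(2)[of "x 1" "x 4"] cross_area_swap(2)[of "x 1" "x 3"])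
    ultimately show ?thesis by (simp add: forall_4)
  qed
  then have "\<exists>k. \<forall>i. c i = k * \<Delta> i" if "affine_dependency x c" for c
    using nz that by (metis nonzero_eq_divide_eq times_divide_eq_left)
  with dep nz show ?thesis using that by blast
qed

text \<open>Expanding the square, the terms that involve \<open>z\<close> are multiples of the two sums that vanish.\<close>

lemma affine_dependency_moment:
  assumes "affine_dependency x \<Delta>"
  shows "(\<Sum>i\<in>UNIV. \<Delta> i * (dist z (x i))\<^sup>2) = (\<Sum>i\<in>UNIV. \<Delta> i * (x i \<bullet> x i))"
proof -
  have "\<Delta> i * (dist z (x i))\<^sup>2 = \<Delta> i * (x i \<bullet> x i) - 2 * (z \<bullet> (\<Delta> i *\<^sub>R x i)) + (z \<bullet> z) * \<Delta> i" for i
    by (simp add: dist_norm power2_norm_eq_inner inner_diff_left inner_diff_right inner_commute algebra_simps)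
  then have "(\<Sum>i\<in>UNIV. \<Delta> i * (dist z (x i))\<^sup>2)
    = (\<Sum>i\<in>UNIV. \<Delta> i * (x i \<bullet> x i)) - 2 * (z \<bullet> (\<Sum>i\<in>UNIV. \<Delta> i *\<^sub>R x i)) + (z \<bullet> z) * sum \<Delta> UNIV"
    by (simp add: sum.distrib sum_subtractf sum_distrib_left inner_sum_right)
  then show ?thesis using assms by (simp add: affine_dependency_def)
qed

lemma other_indices:
  fixes l :: 4
  obtains i j k where "i \<noteq> l" "j \<noteq> l" "k \<noteq> l" "i \<noteq> j" "j \<noteq> k" "i \<noteq> k"
    "UNIV = {i, j, k, l}"
proof -
  have "card (UNIV - {l}) = 3" by simp
  then obtain i j k where "UNIV - {l} = {i, j, k}" "i \<noteq> j" "j \<noteq> k" "i \<noteq> k"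
    unfolding card_3_iff by blast
  then show ?thesis by (intro that[of i j k]) blast+
qed

text \<open>If \<open>\<Delta> l\<close> were zero, the moments \<open>\<Sum>n. \<Delta> n * r\<^sub>a\<^sub>n\<^sup>2\<close> would all equal the one at \<open>a = l\<close>,
which is \<open>s * \<Sum>n. \<Delta> n = 0\<close>. At each of the three other points this moment has only two terms,
so any two of the three other coefficients would have opposite signs.\<close>

lemma dependency_nonzero_at_equidistant:
  assumes "affine_dependency x \<Delta>" and nz: "\<exists>i. \<Delta> i \<noteq> 0" and "inj x"
    and s: "\<And>i. i \<noteq> l \<Longrightarrow> (dist (x i) (x l))\<^sup>2 = s"
  shows "\<Delta> l \<noteq> 0"
proof
  assume l: "\<Delta> l = 0"
  obtain i j k where ijk: "i \<noteq> l" "j \<noteq> l" "k \<noteq> l" "i \<noteq> j" "j \<noteq> k" "i \<noteq> k"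
    and U: "UNIV = {i, j, k, l}" by (rule other_indices)
  have sum: "sum f UNIV = f i + f j + f k + f l" for f :: "4 \<Rightarrow> real"
    unfolding U using ijk by (simp add: add.assoc)
  have mom: "(\<Sum>n\<in>UNIV. \<Delta> n * (dist (x a) (x n))\<^sup>2) = (\<Sum>n\<in>UNIV. \<Delta> n * (dist (x l) (x n))\<^sup>2)" for a
    using affine_dependency_moment[OF assms(1)] by simp
  also have "(\<Sum>n\<in>UNIV. \<Delta> n * (dist (x l) (x n))\<^sup>2) = s * sum \<Delta> UNIV"
    using s ijk l unfolding sum by (simp add: dist_commute algebra_simps)
  also have "\<dots> = 0" using assms(1) by (simp add: affine_dependency_def)
  finally have z: "\<Delta> i * (dist (x a) (x i))\<^sup>2 + \<Delta> j * (dist (x a) (x j))\<^sup>2 + \<Delta> k * (dist (x a) (x k))\<^sup>2 = 0" for a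
    using l unfolding sum by simp
  have d: "(dist (x i) (x j))\<^sup>2 > 0" "(dist (x i) (x k))\<^sup>2 > 0" "(dist (x j) (x k))\<^sup>2 > 0"
    using ijk \<open>inj x\<close> by (simp_all add: inj_eq)
  have opp: "a = 0 \<and> b = 0 \<or> a * b < 0" if "a * r + b * s = 0" "0 < r" "0 < s" for a b r s :: real
  proof -
    have "a = - (b * s / r)" using that by (simp add: field_simps)
    then show ?thesis using that by (auto simp: mult_less_0_iff zero_less_mult_iff zero_less_divide_iff)
  qed
  have "\<Delta> j = 0 \<and> \<Delta> k = 0 \<or> \<Delta> j * \<Delta> k < 0"
    using z[of i] d by (intro opp) auto
  moreover have "\<Delta> i = 0 \<and> \<Delta> k = 0 \<or> \<Delta> i * \<Delta> k < 0"
    using z[of j] d by (intro opp[of _ "(dist (x i) (x j))\<^sup>2" _ "(dist (x j) (x k))\<^sup>2"]) (auto simp: dist_commute)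
  moreover have "\<Delta> i = 0 \<and> \<Delta> j = 0 \<or> \<Delta> i * \<Delta> j < 0"
    using z[of k] d by (intro opp[of _ "(dist (x i) (x k))\<^sup>2" _ "(dist (x j) (x k))\<^sup>2"]) (auto simp: dist_commute)
  ultimately have "\<Delta> i = 0" "\<Delta> j = 0" "\<Delta> k = 0" by (auto simp: mult_less_0_iff)
  with l have "\<Delta> n = 0" for n using U by (metis UNIV_I empty_iff insert_iff)
  with nz show False by simp
qed

text \<open>Three collinear points have a dependency of their own; extended by zero it is a multiple of
\<open>\<Delta>\<close> that vanishes at the fourth point.\<close>

lemma no_three_collinear_if_all_nonzero:
  assumes "inj x" and spans: "\<And>c. affine_dependency x c \<Longrightarrow> \<exists>k. \<forall>i. c i = k * \<Delta> i"
    and "\<And>i. \<Delta> i \<noteq> 0"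
  shows "no_three_collinear x"
  unfolding no_three_collinear_def
proof (intro allI impI notI)
  fix i j k :: 4
  assume ijk: "i \<noteq> j" "j \<noteq> k" "i \<noteq> k" and "collinear {x i, x j, x k}"
  then obtain u where u: "x j = u *\<^sub>R x i + (1 - u) *\<^sub>R x k"
    using \<open>inj x\<close> by (auto simp: collinear_3_expand inj_eq)
  define c :: "4 \<Rightarrow> real" where
    "c n = (if n = i then u else 0) + (if n = k then 1 - u else 0) - (if n = j then 1 else 0)" for n
  have "sum c UNIV = 0"
    by (simp add: c_def sum.distrib sum_subtractf)
  moreover have "(\<Sum>n\<in>UNIV. c n *\<^sub>R x n) = 0"
    by (simp add: c_def sum.distrib sum_subtractf scaleR_add_left scaleR_diff_left if_distrib[of "\<lambda>a. a *\<^sub>R _"] u cong: if_cong)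
  ultimately obtain K where K: "\<And>n. c n = K * \<Delta> n"
    using spans[of c] by (auto simp: affine_dependency_def)
  have "card {i, j, k} \<noteq> card (UNIV :: 4 set)" using ijk by simp
  then have "{i, j, k} \<noteq> UNIV" by metis
  then obtain l where "l \<notin> {i, j, k}" by blast
  then have "K = 0" using K[of l] assms(3)[of l] by (simp add: c_def)
  then show False using K[of j] ijk by (simp add: c_def)
qed

section \<open>Position of the vortices from the signs of the dependency\<close>

text \<open>Solving the dependency for \<open>x l\<close> writes it as a combination of the other three points with
positive coefficients of sum one.\<close>

lemma interior_vortexI:
  assumes "affine_dependency x \<Delta>" "no_three_collinear x" and opp: "\<And>n. n \<noteq> l \<Longrightarrow> \<Delta> n * \<Delta> l < 0"
  shows "interior_vortex x l"
proof -
  obtain i j k where ijk: "i \<noteq> l" "j \<noteq> l" "k \<noteq> l" "i \<noteq> j" "j \<noteq> k" "i \<noteq> k"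
    and U: "UNIV = {i, j, k, l}" by (rule other_indices)
  have rest: "UNIV - {l} = {i, j, k}" using U ijk by auto
  have "\<Delta> l \<noteq> 0" using opp[of i] ijk by auto
  define b where "b n = - \<Delta> n / \<Delta> l" for n
  have pos: "0 < b n" if "n \<noteq> l" for n
    using opp[OF that] by (auto simp: b_def mult_less_0_iff divide_neg_pos divide_pos_neg)
  have "\<Delta> i + \<Delta> j + \<Delta> k + \<Delta> l = 0" "\<Delta> i *\<^sub>R x i + \<Delta> j *\<^sub>R x j + \<Delta> k *\<^sub>R x k + \<Delta> l *\<^sub>R x l = 0"
    using assms(1) ijk unfolding affine_dependency_def U by (simp_all add: add.assoc)
  then have "b i + b j + b k = 1" "b i *\<^sub>R x i + b j *\<^sub>R x j + b k *\<^sub>R x k = x l"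
  proof -
    assume s: "\<Delta> i + \<Delta> j + \<Delta> k + \<Delta> l = 0"
    have "b i + b j + b k = - (\<Delta> i + \<Delta> j + \<Delta> k) / \<Delta> l"
      by (simp add: b_def add_divide_distrib diff_divide_distrib)
    also have "- (\<Delta> i + \<Delta> j + \<Delta> k) = \<Delta> l" using s by simp
    finally show "b i + b j + b k = 1" using \<open>\<Delta> l \<noteq> 0\<close> by simp
    assume "\<Delta> i *\<^sub>R x i + \<Delta> j *\<^sub>R x j + \<Delta> k *\<^sub>R x k + \<Delta> l *\<^sub>R x l = 0"
    then have "\<Delta> i *\<^sub>R x i + \<Delta> j *\<^sub>R x j + \<Delta> k *\<^sub>R x k = - \<Delta> l *\<^sub>R x l"
      by (simp add: eq_neg_iff_add_eq_0)
    then have "(- 1 / \<Delta> l) *\<^sub>R (\<Delta> i *\<^sub>R x i + \<Delta> j *\<^sub>R x j + \<Delta> k *\<^sub>R x k) = (- 1 / \<Delta> l) *\<^sub>R (- \<Delta> l *\<^sub>R x l)"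
      by simp
    then show "b i *\<^sub>R x i + b j *\<^sub>R x j + b k *\<^sub>R x k = x l"
      using \<open>\<Delta> l \<noteq> 0\<close> by (simp add: b_def scaleR_add_right)
  qed
  moreover have "\<not> collinear {x i, x j, x k}"
    using assms(2) ijk unfolding no_three_collinear_def by blast
  then have "interior (convex hull {x i, x j, x k}) =
      {v. \<exists>a b c. 0 < a \<and> 0 < b \<and> 0 < c \<and> a + b + c = 1 \<and> a *\<^sub>R x i + b *\<^sub>R x j + c *\<^sub>R x k = v}"
    by (rule interior_convex_hull_3_minimal) simp
  moreover have "0 < b i" "0 < b j" "0 < b k" using pos ijk by auto
  ultimately have "x l \<in> interior (convex hull {x i, x j, x k})" by blast
  then show ?thesis unfolding interior_vortex_def rest by simp
qed

text \<open>Had \<open>x l\<close> nonnegative barycentric coordinates with respect to the other points, the resulting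
dependency, and hence \<open>\<Delta>\<close>, would have no other coefficient of the strict sign of \<open>\<Delta> l\<close>.\<close>

lemma convex_configI:
  assumes spans: "\<And>c. affine_dependency x c \<Longrightarrow> \<exists>k. \<forall>i. c i = k * \<Delta> i"
    and "no_three_collinear x" and same: "\<And>l. \<exists>n. n \<noteq> l \<and> 0 < \<Delta> n * \<Delta> l"
  shows "convex_config x"
  unfolding convex_config_def
proof (intro conjI allI notI)
  fix l :: 4
  obtain i j k where ijk: "i \<noteq> l" "j \<noteq> l" "k \<noteq> l" "i \<noteq> j" "j \<noteq> k" "i \<noteq> k"
    and U: "UNIV = {i, j, k, l}" by (rule other_indices)
  have rest: "UNIV - {l} = {i, j, k}" using U ijk by auto
  assume "x l \<in> convex hull (x ` (UNIV - {l}))"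
  then obtain a b c where abc: "0 \<le> a" "0 \<le> b" "0 \<le> c" "a + b + c = 1"
    and xl: "x l = a *\<^sub>R x i + b *\<^sub>R x j + c *\<^sub>R x k"
    unfolding rest by (auto simp: convex_hull_3)
  define e :: "4 \<Rightarrow> real" where "e n = (if n = i then a else if n = j then b else if n = k then c else -1)" for n
  have "affine_dependency x e"
    using ijk abc xl unfolding affine_dependency_def U by (simp add: e_def)
  then obtain K where K: "\<And>n. e n = K * \<Delta> n" using spans by blast
  have "K \<noteq> 0" using K[of l] ijk by (auto simp: e_def)
  obtain n where n: "n \<noteq> l" "0 < \<Delta> n * \<Delta> l" using same by blast
  then have "n = i \<or> n = j \<or> n = k" using U by blast
  then have "0 \<le> e n" using abc by (auto simp: e_def)
  have "0 < K\<^sup>2 * (\<Delta> n * \<Delta> l)" using n \<open>K \<noteq> 0\<close> by simp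
  also have "\<dots> = e n * e l" unfolding K by (simp add: power2_eq_square mult_ac)
  also have "\<dots> \<le> 0" using \<open>0 \<le> e n\<close> ijk by (simp add: e_def)
  finally show False by simp
qed (rule assms)

text \<open>A common point of the line through \<open>x i\<close> and \<open>x j\<close> and of the segment from \<open>x k\<close> to \<open>x l\<close> would
give a dependency whose coefficients at \<open>k\<close> and \<open>l\<close> do not have opposite signs. As there is none,
the hull of \<open>x i\<close> and \<open>x j\<close> is a face.\<close>

lemma adjacentI:
  fixes i j k l :: 4
  assumes spans: "\<And>c. affine_dependency x c \<Longrightarrow> \<exists>k. \<forall>i. c i = k * \<Delta> i"
    and "inj x" and U: "UNIV = {i, j, k, l}" and ij: "i \<noteq> j" "i \<noteq> k" "i \<noteq> l" "j \<noteq> k" "j \<noteq> l" "k \<noteq> l"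
    and opp: "\<Delta> k * \<Delta> l < 0"
  shows "adjacent x i j"
proof -
  have range: "range x = {x i, x j, x k, x l}" using U by (metis image_empty image_insert)
  have diff: "range x - {x i, x j} = {x k, x l}"
    unfolding range using ij \<open>inj x\<close> by (auto simp: inj_eq)
  have "affine hull {x i, x j} \<inter> convex hull (range x - {x i, x j}) = {}"
  proof (rule ccontr)
    assume "\<not> ?thesis"
    then obtain a b c d where "a + b = 1" "0 \<le> c" "0 \<le> d" "c + d = 1"
      and eq: "a *\<^sub>R x i + b *\<^sub>R x j = c *\<^sub>R x k + d *\<^sub>R x l"
      unfolding diff by (auto simp: convex_hull_2 affine_hull_2)
    define e :: "4 \<Rightarrow> real" where "e n = (if n = i then a else if n = j then b else if n = k then - c else - d)" for n
    have "affine_dependency x e"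
      using ij \<open>a + b = 1\<close> \<open>c + d = 1\<close> eq unfolding affine_dependency_def U
      by (simp add: e_def algebra_simps)
    then obtain K where K: "\<And>n. e n = K * \<Delta> n" using spans by blast
    have "K \<noteq> 0"
    proof
      assume "K = 0"
      then have "c = 0" "d = 0" using K[of k] K[of l] ij by (auto simp: e_def)
      with \<open>c + d = 1\<close> show False by simp
    qed
    then have "K\<^sup>2 * (\<Delta> k * \<Delta> l) < 0"
      using opp by (simp add: mult_pos_neg)
    moreover have "K\<^sup>2 * (\<Delta> k * \<Delta> l) = e k * e l" unfolding K by (simp add: power2_eq_square mult_ac)
    moreover have "0 \<le> e k * e l" using ij \<open>0 \<le> c\<close> \<open>0 \<le> d\<close> by (simp add: e_def)
    ultimately show False by simp
  qed
  then have "(convex hull {x i, x j}) face_of (convex hull (range x))"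
    by (intro face_of_convex_hulls) auto
  moreover have "x i \<noteq> x j" using ij \<open>inj x\<close> by (simp add: inj_eq)
  ultimately show ?thesis
    unfolding adjacent_def edge_of_def segment_convex_hull by (simp add: aff_dim_convex_hull)
qed

section \<open>Symmetric configurations\<close>

text \<open>The reflection in the perpendicular bisector of \<open>A\<close> and \<open>B\<close> exchanges the ends of every segment
that is parallel to \<open>A - B\<close> and has its midpoint on the bisector. With \<open>p = q\<close> and \<open>s = 0\<close> this
covers the fixed points.\<close>

lemma bisector_reflection_swaps:
  assumes "A \<noteq> B" and pq: "p - q = s *\<^sub>R (A - B)" and mid: "(p + q - (A + B)) \<bullet> (A - B) = 0"
  shows "reflect_line (midpoint A B) (sgn (A - B)) p = q"
proof -
  define v where "v = A - B"
  have v: "v \<bullet> v \<noteq> 0" using assms by (simp add: v_def)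
  have refl: "reflect_line (midpoint A B) (sgn v) p = p - (2 * ((p - midpoint A B) \<bullet> v) / (v \<bullet> v)) *\<^sub>R v"
    by (simp add: reflect_line_def sgn_div_norm power2_norm_eq_inner[symmetric] power2_eq_square divide_inverse mult_ac)
  have "2 * ((p - midpoint A B) \<bullet> v) = (p + q - (A + B)) \<bullet> v + (p - q) \<bullet> v"
    by (simp add: midpoint_def inner_diff_left inner_add_left field_simps)
  then have P: "2 * ((p - midpoint A B) \<bullet> v) = s * (v \<bullet> v)"
    using mid pq by (simp add: v_def)
  have "p - s *\<^sub>R v = q" using pq by (simp add: v_def algebra_simps)
  then show ?thesis
    unfolding v_def[symmetric] refl P using v by simp
qed

lemma kite_symmetric:
  fixes i j k l :: 4
  assumes U: "UNIV = {i, j, k, l}" and "x i \<noteq> x j"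
    and d: "dist (x i) (x k) = dist (x j) (x k)" "dist (x i) (x l) = dist (x j) (x l)"
  shows "has_line_of_symmetry x"
proof -
  define a where "a = midpoint (x i) (x j)"
  define n where "n = sgn (x i - x j)"
  note swap = bisector_reflection_swaps[OF assms(2), folded a_def n_def]
  have n: "norm n = 1" using assms(2) by (simp add: n_def norm_sgn)
  have "reflect_line a n z = z" if "dist (x i) z = dist (x j) z" for z
  proof (rule swap[of _ _ 0])
    have "(dist (x i) z)\<^sup>2 = (dist (x j) z)\<^sup>2" using that by simp
    then show "(z + z - (x i + x j)) \<bullet> (x i - x j) = 0"
      by (simp only: dist_norm power2_norm_eq_inner inner_diff_left inner_diff_right inner_add_left
          inner_add_right inner_commute)
  qed simp
  then have "reflect_line a n (x k) = x k" "reflect_line a n (x l) = x l"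
    using d by auto
  moreover have "reflect_line a n (x i) = x j" by (rule swap[of _ _ 1]) auto
  moreover have "reflect_line a n (x j) = x i" by (rule swap[of _ _ "-1"]) (auto simp: add.commute)
  moreover have "range x = {x i, x j, x k, x l}" using U by (metis image_empty image_insert)
  ultimately have "reflect_line a n ` range x = range x" by auto
  with n show ?thesis unfolding has_line_of_symmetry_def by blast
qed

text \<open>The two distance equations alone also hold in a parallelogram with diagonals \<open>i j\<close> and \<open>k l\<close>;
parallelism excludes it, as it makes these two pairs of points a pair of opposite sides.\<close>

lemma trapezoid_symmetric:
  fixes i j k l :: 4
  assumes U: "UNIV = {i, j, k, l}" and "x i \<noteq> x j"
    and parallel: "x k - x l = t *\<^sub>R (x i - x j)"
    and d: "dist (x i) (x k) = dist (x j) (x l)" "dist (x i) (x l) = dist (x j) (x k)"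
  shows "has_line_of_symmetry x"
proof -
  define a where "a = midpoint (x i) (x j)"
  define n where "n = sgn (x i - x j)"
  note swap = bisector_reflection_swaps[OF assms(2), folded a_def n_def]
  have n: "norm n = 1" using assms(2) by (simp add: n_def norm_sgn)
  have "(dist (x i) (x k))\<^sup>2 + (dist (x i) (x l))\<^sup>2 = (dist (x j) (x l))\<^sup>2 + (dist (x j) (x k))\<^sup>2"
    using d by simp
  then have mid: "(x k + x l - (x i + x j)) \<bullet> (x i - x j) = 0"
    by (simp add: dist_norm power2_norm_eq_inner inner_diff_left inner_diff_right inner_add_left
          inner_add_right inner_commute)
  have "reflect_line a n (x k) = x l" by (rule swap[OF parallel mid])
  moreover have "reflect_line a n (x l) = x k"
  proof (rule swap[of _ _ "- t"])
    show "x l - x k = - t *\<^sub>R (x i - x j)" using parallel by (metis minus_diff_eq scaleR_minus_left)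
  qed (use mid in \<open>simp add: add.commute\<close>)
  moreover have "reflect_line a n (x i) = x j" by (rule swap[of _ _ 1]) auto
  moreover have "reflect_line a n (x j) = x i" by (rule swap[of _ _ "-1"]) (auto simp: add.commute)
  moreover have "range x = {x i, x j, x k, x l}" using U by (metis image_empty image_insert)
  ultimately have "reflect_line a n ` range x = range x" by auto
  with n show ?thesis unfolding has_line_of_symmetry_def by blast
qed

section \<open>Mutual distances of a relative equilibrium\<close>

text \<open>The numbers \<open>\<Gamma> i * \<Gamma> j * (1 / r\<^sub>i\<^sub>j\<^sup>2 - w)\<close> form the off-diagonal part of a symmetric matrix
whose rows are affine dependencies. Since the space of dependencies is spanned by \<open>\<Delta>\<close>, the matrix
is \<open>\<sigma>\<close> times the product of the column \<open>\<Delta>\<close> with its transpose.\<close>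

lemma vortex_parametrisation:
  assumes eq: "relative_equilibrium \<Gamma> x" and planar: "strictly_planar x" and G: "sum \<Gamma> UNIV \<noteq> 0"
  obtains \<Delta> w \<sigma> where "affine_dependency x \<Delta>" "\<And>i. \<Delta> i \<noteq> 0" "w \<noteq> 0"
    and "\<And>c. affine_dependency x c \<Longrightarrow> \<exists>k. \<forall>i. c i = k * \<Delta> i"
    and "\<And>i j. i \<noteq> j \<Longrightarrow> (dist (x i) (x j))\<^sup>2 * (w + \<sigma> * (\<Delta> i / \<Gamma> i) * (\<Delta> j / \<Gamma> j)) = 1"
proof -
  from eq obtain l c where "inj x" and \<Gamma>: "\<And>i. \<Gamma> i \<noteq> 0" and "l \<noteq> 0"
    and lc: "\<And>i. - (l *\<^sub>R (x i - c)) = (\<Sum>j\<in>UNIV - {i}. (\<Gamma> j / (dist (x i) (x j))\<^sup>2) *\<^sub>R (x j - x i))"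
    unfolding relative_equilibrium_def by blast
  define s where "s i j = (dist (x i) (x j))\<^sup>2" for i j
  have s_sym: "s i j = s j i" for i j by (simp add: s_def dist_commute)
  have s_nz: "s i j \<noteq> 0" if "i \<noteq> j" for i j
    using that \<open>inj x\<close> by (simp add: s_def inj_eq)
  have force: "(\<Sum>j\<in>UNIV. (\<Gamma> j / s i j) *\<^sub>R (x j - x i)) = - (l *\<^sub>R (x i - c))" for i
    unfolding lc s_def by (rule sum.mono_neutral_right) auto
  \<comment> \<open>The pair forces are antisymmetric, so the total weighted force \<open>V\<close> vanishes and \<open>c\<close> is the centre of vorticity.\<close>
  define V where "V = (\<Sum>i\<in>UNIV. \<Sum>j\<in>UNIV. (\<Gamma> i * \<Gamma> j / s i j) *\<^sub>R (x j - x i))"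
  have "V = (\<Sum>j\<in>UNIV. \<Sum>i\<in>UNIV. (\<Gamma> i * \<Gamma> j / s i j) *\<^sub>R (x j - x i))"
    unfolding V_def by (rule sum.swap)
  also have "\<dots> = (\<Sum>j\<in>UNIV. \<Sum>i\<in>UNIV. - ((\<Gamma> j * \<Gamma> i / s j i) *\<^sub>R (x i - x j)))"
    by (intro sum.cong refl) (simp add: s_sym mult.commute algebra_simps)
  also have "\<dots> = - V" by (simp add: V_def sum_negf)
  finally have "V = 0" by (simp add: eq_neg_iff_add_eq_0 flip: scaleR_2)
  moreover have "V = (\<Sum>i\<in>UNIV. \<Gamma> i *\<^sub>R - (l *\<^sub>R (x i - c)))"
    unfolding V_def force[symmetric] by (simp add: scaleR_sum_right)
  also have "\<dots> = - l *\<^sub>R ((\<Sum>i\<in>UNIV. \<Gamma> i *\<^sub>R x i) - sum \<Gamma> UNIV *\<^sub>R c)"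
    by (simp add: scaleR_sum_left scaleR_sum_right scaleR_diff_right sum_subtractf sum_negf algebra_simps)
  ultimately have centre: "(\<Sum>i\<in>UNIV. \<Gamma> i *\<^sub>R x i) = sum \<Gamma> UNIV *\<^sub>R c"
    using \<open>l \<noteq> 0\<close> by simp
  define w where "w = l / sum \<Gamma> UNIV"
  have w: "w * sum \<Gamma> UNIV = l" "w \<noteq> 0" using G \<open>l \<noteq> 0\<close> by (simp_all add: w_def)
  obtain \<Delta> where \<Delta>: "affine_dependency x \<Delta>" "\<exists>i. \<Delta> i \<noteq> 0"
    and spans: "\<And>c. affine_dependency x c \<Longrightarrow> \<exists>k. \<forall>i. c i = k * \<Delta> i"
    using dependency_space_1_dim[OF planar \<open>inj x\<close>] by blast
  have "\<exists>k. \<forall>j. j \<noteq> i \<longrightarrow> \<Gamma> j * (1 / s i j - w) = k * \<Delta> j" for i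
  proof -
    define e where "e j = \<Gamma> j * (1 / s i j - w)" for j
    \<comment> \<open>As \<open>1 / 0 = 0\<close>, the entry \<open>e i\<close> is \<open>- \<Gamma> i * w\<close>; it does not contribute to the vector sum below.\<close>
    define f where "f j = e j - (if j = i then sum e UNIV else 0)" for j
    have "(\<Sum>j\<in>UNIV. f j *\<^sub>R x j) = (\<Sum>j\<in>UNIV. e j *\<^sub>R x j) - sum e UNIV *\<^sub>R x i"
      by (simp add: f_def scaleR_diff_left sum_subtractf if_distrib[of "\<lambda>a. a *\<^sub>R _"] cong: if_cong)
    also have "\<dots> = (\<Sum>j\<in>UNIV. e j *\<^sub>R (x j - x i))"
      by (simp add: scaleR_diff_right sum_subtractf scaleR_sum_left)
    also have "\<dots> = (\<Sum>j\<in>UNIV. (\<Gamma> j / s i j) *\<^sub>R (x j - x i)) - w *\<^sub>R (\<Sum>j\<in>UNIV. \<Gamma> j *\<^sub>R (x j - x i))"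
      by (simp add: e_def scaleR_sum_right algebra_simps flip: sum_subtractf)
    also have "(\<Sum>j\<in>UNIV. \<Gamma> j *\<^sub>R (x j - x i)) = sum \<Gamma> UNIV *\<^sub>R (c - x i)"
      using centre by (simp add: scaleR_diff_right sum_subtractf scaleR_sum_left)
    also have "(\<Sum>j\<in>UNIV. (\<Gamma> j / s i j) *\<^sub>R (x j - x i)) - w *\<^sub>R (sum \<Gamma> UNIV *\<^sub>R (c - x i)) = 0"
      unfolding force scaleR_scaleR w by (simp add: algebra_simps)
    finally have "affine_dependency x f"
      by (simp add: affine_dependency_def f_def sum_subtractf)
    then obtain k where "\<And>j. f j = k * \<Delta> j" using spans by blast
    then have "\<Gamma> j * (1 / s i j - w) = k * \<Delta> j" if "j \<noteq> i" for j
      using that by (simp add: f_def e_def flip: \<open>\<And>j. f j = k * \<Delta> j\<close>)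
    then show ?thesis by blast
  qed
  then obtain k where k: "\<And>i j. j \<noteq> i \<Longrightarrow> \<Gamma> j * (1 / s i j - w) = k i * \<Delta> j"
    by metis
  have nz: "\<Delta> n \<noteq> 0" for n
  proof
    assume "\<Delta> n = 0"
    have "s i n = 1 / w" if "i \<noteq> n" for i
    proof -
      have "1 / s i n = w" using k[of n i] that \<open>\<Delta> n = 0\<close> \<Gamma>[of n] by simp
      then show ?thesis by (metis div_by_1 divide_divide_eq_right mult_1)
    qed
    then have "\<Delta> n \<noteq> 0"
      by (intro dependency_nonzero_at_equidistant[OF \<Delta> \<open>inj x\<close>, of n "1 / w"]) (simp add: s_def)
    with \<open>\<Delta> n = 0\<close> show False by simp
  qed
  define u where "u i = \<Delta> i / \<Gamma> i" for i
  have u: "u i \<noteq> 0" for i using nz \<Gamma> by (simp add: u_def)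
  have d: "1 / s i j - w = k i * u j" if "i \<noteq> j" for i j
    using k[of j i] that \<Gamma>[of j] by (simp add: u_def field_simps)
  define \<sigma> where "\<sigma> = k 1 / u 1"
  have "k i = \<sigma> * u i" for i
  proof (cases "i = 1")
    case True
    then show ?thesis using u by (simp add: \<sigma>_def)
  next
    case False
    then have "k i * u 1 = k 1 * u i" using d[of i 1] d[of 1 i] s_sym[of i 1] by simp
    then show ?thesis using u[of 1] by (simp add: \<sigma>_def field_simps)
  qed
  then have "s i j * (w + \<sigma> * u i * u j) = 1" if "i \<noteq> j" for i j
    using d[OF that] s_nz[OF that] by (simp add: field_simps)
  then show ?thesis
    using that[OF \<Delta>(1) nz w(2) spans, of \<sigma>] unfolding u_def s_def by blast
qed

section \<open>Elimination\<close>

text \<open>This compares the moments at two vortices \<open>a\<close>, \<open>b\<close> of equal strength. The numbers \<open>S\<close> are the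
squared distances multiplied by \<open>w\<close>, the letters \<open>a\<close>, \<open>b\<close>, \<open>c\<close>, \<open>d\<close> stand for the values of \<open>u\<close>,
and \<open>\<mu>\<close> is the strength of the other pair relative to that of \<open>a\<close>, \<open>b\<close>. Each term of the
difference of the moments contains the factor \<open>b - a\<close>, because
\<open>Sac - Sbc = \<tau> * c * (b - a) * Sac * Sbc\<close>. What remains is symmetric in \<open>a\<close>, \<open>b\<close> and in \<open>c\<close>, \<open>d\<close>
and of even degree; as \<open>a + b\<close> is a multiple of \<open>c + d\<close>, it is a polynomial in \<open>p\<close>, \<open>q\<close>, \<open>B\<close>.\<close>

lemma pair_balance:
  fixes a b c d \<tau> \<mu> :: real
  assumes "(1 + \<tau> * a * b) * Sab = 1"
    and ac: "(1 + \<tau> * a * c) * Sac = 1" and ad: "(1 + \<tau> * a * d) * Sad = 1"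
    and bc: "(1 + \<tau> * b * c) * Sbc = 1" and bd: "(1 + \<tau> * b * d) * Sbd = 1"
    and weights: "a + b + \<mu> * (c + d) = 0"
    and "a \<noteq> b"
    and eq: "b * Sab + \<mu> * (c * Sac + d * Sad) = a * Sab + \<mu> * (c * Sbc + d * Sbd)"
    and p: "p = \<tau> * a * b" and q: "q = \<tau> * c * d" and B: "B = \<tau> * (c + d)\<^sup>2"
  shows "(1 + \<mu>) * p * B * (1 - \<mu> * q) + (1 - p * q) * (1 - p * q - 2 * \<mu> * q * (1 + p)) = 0"
proof -
  have c: "Sac - Sbc = \<tau> * c * (b - a) * Sac * Sbc"
    using ac bc by algebra
  have d: "Sad - Sbd = \<tau> * d * (b - a) * Sad * Sbd"
    using ad bd by algebra
  have "(b - a) * Sab + \<mu> * (c * (Sac - Sbc) + d * (Sad - Sbd)) = 0"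
    using eq by (simp add: algebra_simps)
  then have "(b - a) * (Sab + \<mu> * \<tau> * (c\<^sup>2 * Sac * Sbc + d\<^sup>2 * Sad * Sbd)) = 0"
    unfolding c d by (simp add: algebra_simps power2_eq_square)
  with \<open>a \<noteq> b\<close> have F: "Sab + \<mu> * \<tau> * (c\<^sup>2 * (Sac * Sbc) + d\<^sup>2 * (Sad * Sbd)) = 0"
    by (simp add: mult.assoc)
  define P Q where "P = (1 + \<tau> * a * c) * (1 + \<tau> * b * c)"
    and "Q = (1 + \<tau> * a * d) * (1 + \<tau> * b * d)"
  have P: "P * (Sac * Sbc) = 1" and Q: "Q * (Sad * Sbd) = 1"
    using ac bc ad bd unfolding P_def Q_def by algebra+
  have "P * Q + \<mu> * \<tau> * (1 + \<tau> * a * b) * (c\<^sup>2 * Q + d\<^sup>2 * P) = 0"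
    using F P Q assms(1) by algebra
  moreover have "a = - b - \<mu> * (c + d)" using weights by linarith
  ultimately show ?thesis
    unfolding P_def Q_def p q B by algebra
qed

text \<open>The sum of the moments, each multiplied by \<open>\<Gamma> i * u i\<close>, is a multiple of \<open>\<Sum>i. \<Gamma> i * u i = 0\<close>. Since
\<open>\<tau> * u i * u j * S\<^sub>i\<^sub>j = 1 - S\<^sub>i\<^sub>j\<close>, this reads \<open>\<Sum>i<j. \<Gamma> i * \<Gamma> j * (1 - S\<^sub>i\<^sub>j) = 0\<close>, the relation
between the moment of inertia and \<open>\<lambda>\<close>. The quantity \<open>R\<close> is the common denominator of the four
distances that join the two pairs.\<close>

lemma inertia_balance:
  fixes a b c d \<tau> m :: real
  assumes ab: "(1 + \<tau> * a * b) * Sab = 1" and cd: "(1 + \<tau> * c * d) * Scd = 1"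
    and ac: "(1 + \<tau> * a * c) * Sac = 1" and ad: "(1 + \<tau> * a * d) * Sad = 1"
    and bc: "(1 + \<tau> * b * c) * Sbc = 1" and bd: "(1 + \<tau> * b * d) * Sbd = 1"
    and weights: "a + b + m * (c + d) = 0"
    and ta: "b * Sab + m * (c * Sac + d * Sad) = t" and tb: "a * Sab + m * (c * Sbc + d * Sbd) = t"
    and tc: "a * Sac + b * Sbc + m * (d * Scd) = t" and td: "a * Sad + b * Sbd + m * (c * Scd) = t"
    and p: "p = \<tau> * a * b" and q: "q = \<tau> * c * d" and B: "B = \<tau> * (c + d)\<^sup>2"
    and R: "R = (1 - p * q)\<^sup>2 - B * (m - p) * (1 - m * q)"
  shows "m * (B * (m - 2 * p - 2 * m\<^sup>2 * q + 3 * m * p * q) + 4 * p * q * (1 - p * q)) * ((1 + p) * (1 + q))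
     = R * (p * (1 + q) + m\<^sup>2 * q * (1 + p))"
    and "R * (Sac * Sbc * Sad * Sbd) = 1"
proof -
  have a: "a = - b - m * (c + d)" using weights by linarith
  define P Q where "P = (1 + \<tau> * a * c) * (1 + \<tau> * b * c)"
    and "Q = (1 + \<tau> * a * d) * (1 + \<tau> * b * d)"
  have PQ: "R = P * Q" unfolding R P_def Q_def p q B a by algebra
  have "P * (Sac * Sbc) = 1" "Q * (Sad * Sbd) = 1"
    using ac bc ad bd unfolding P_def Q_def by algebra+
  then show "R * (Sac * Sbc * Sad * Sbd) = 1"
    unfolding PQ by algebra
  have "a * (b * Sab + m * (c * Sac + d * Sad)) + b * (a * Sab + m * (c * Sbc + d * Sbd))
      + m * (c * (a * Sac + b * Sbc + m * (d * Scd)) + d * (a * Sad + b * Sbd + m * (c * Scd)))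
      = t * (a + b + m * (c + d))"
    unfolding ta tb tc td by (simp add: algebra_simps)
  then have "a * b * Sab + m\<^sup>2 * (c * d * Scd) + m * (a * c * Sac + a * d * Sad + b * c * Sbc + b * d * Sbd) = 0"
    using weights by algebra
  then have "\<tau> * (a * b * Sab + m\<^sup>2 * (c * d * Scd) + m * (a * c * Sac + a * d * Sad + b * c * Sbc + b * d * Sbd)) = 0"
    by simp
  then have S: "(1 - Sab) + m\<^sup>2 * (1 - Scd) + m * (4 - (Sac + Sbc + Sad + Sbd)) = 0"
    using ab cd ac ad bc bd by algebra
  have "R * (Sac + Sbc + Sad + Sbd) = (2 + \<tau> * c * (a + b)) * Q + (2 + \<tau> * d * (a + b)) * P"
    using ac bc ad bd unfolding PQ P_def Q_def by algebra
  also have "\<dots> = 4 * R + B * (m - 2 * p - 2 * m\<^sup>2 * q + 3 * m * p * q) + 4 * p * q * (1 - p * q)"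
    unfolding R P_def Q_def p q B a by algebra
  finally have N: "R * (4 - (Sac + Sbc + Sad + Sbd)) = - (B * (m - 2 * p - 2 * m\<^sup>2 * q + 3 * m * p * q) + 4 * p * q * (1 - p * q))"
    by (simp add: algebra_simps)
  have "(1 + p) * (1 + q) * R * ((1 - Sab) + m\<^sup>2 * (1 - Scd) + m * (4 - (Sac + Sbc + Sad + Sbd))) = 0"
    unfolding S by simp
  moreover have "(1 + p) * (1 - Sab) = p" "(1 + q) * (1 - Scd) = q"
    using ab cd unfolding p q by algebra+
  ultimately show "m * (B * (m - 2 * p - 2 * m\<^sup>2 * q + 3 * m * p * q) + 4 * p * q * (1 - p * q)) * ((1 + p) * (1 + q))
     = R * (p * (1 + q) + m\<^sup>2 * q * (1 + p))"
    using N by algebra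
qed

text \<open>The variables are \<open>r = p / m\<close>, \<open>y = m * q\<close> and \<open>C = m * B\<close>; in them the exchange of the two pairs is
the exchange of \<open>r\<close> and \<open>y\<close> together with that of \<open>m\<close> and \<open>1 / m\<close>. If neither \<open>r\<close> nor \<open>y\<close> is
\<open>1\<close>, the first two equations determine \<open>m = A / D\<close> and \<open>C = - ((1 - r * y)\<^sup>2 * L) / (A + D)\<close> as rational
functions of \<open>r\<close> and \<open>y\<close>. Substituted into the third one, they leave
\<open>L * K1 * K2 = 0\<close>. The factor \<open>L\<close> belongs to \<open>C = 0\<close>, the factors \<open>K1\<close> and \<open>K2\<close> to infinite
distances, \<open>1 + p = 0\<close> or \<open>1 + q = 0\<close>.\<close>

lemma elimination_branches:
  fixes r y m C :: real
  assumes E12: "(1 + m) * r * C * (1 - y) + (1 - r*y) * (1 - r*y - 2*y - 2*m*(r*y)) = 0"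
    and E34: "(1 + m) * y * C * (1 - r) + (1 - r*y) * (m * (1 - r*y - 2*r) - 2*(r*y)) = 0"
    and T: "(C * (1 - 2*r - 2*y + 3*(r*y)) + 4*(r*y) * (1 - r*y)) * ((1 + m*r) * (m + y))
            = ((1 - r*y)\<^sup>2 - C * (1 - r) * (1 - y)) * (m * (r + y) + (1 + m\<^sup>2) * (r*y))"
    and R: "(1 - r*y)\<^sup>2 - C * (1 - r) * (1 - y) \<noteq> 0"
    and "m \<noteq> -1" "r \<noteq> 0" "y \<noteq> 0" "C \<noteq> 0" "1 + m * r \<noteq> 0" "m + y \<noteq> 0"
  shows "r = 1 \<or> y = 1"
proof (rule ccontr)
  assume "\<not> ?thesis"
  then have r1: "1 - r \<noteq> 0" and y1: "1 - y \<noteq> 0" by auto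
  have pi1: "1 - r*y \<noteq> 0"
  proof
    assume "1 - r*y = 0"
    then have "(1 + m) * r * C * (1 - y) = 0" using E12 by simp
    then show False using \<open>m \<noteq> -1\<close> \<open>r \<noteq> 0\<close> \<open>C \<noteq> 0\<close> y1 by (simp add: add_eq_0_iff)
  qed
  define L where "L = 1 - 2*r - 2*y + 3*(r*y)"
  define D where "D = r * ((1 - y) * (1 - 2*r - r*y) + 2*y\<^sup>2 * (1 - r))"
  define A where "A = y * ((1 - r) * (1 - 2*y - r*y) + 2*r\<^sup>2 * (1 - y))"
  define K1 where "K1 = 2*r - 1 - r*y"
  define K2 where "K2 = 2*y - 1 - r*y"
  define W where "W = r + y - 2*r\<^sup>2 - 2*y\<^sup>2 - 6*r*y + 10*r\<^sup>2*y + 10*r*y\<^sup>2 - 6*r^3*y - 6*r*y^3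
     - 8*r\<^sup>2*y\<^sup>2 + 5*r^3*y\<^sup>2 + 5*r\<^sup>2*y^3 - 2*r^3*y^3"
  \<comment> \<open>Eliminating \<open>C\<close> from the first two equations leaves a relation linear in \<open>m\<close>.\<close>
  have "(1 - r*y) * (m * D - A) = 0"
    using E12 E34 unfolding A_def D_def by algebra
  with pi1 have mD: "m * D = A" by simp
  have "r * (1 - y) * ((1 + m) * C * D + (1 - r*y)\<^sup>2 * L) = 0"
    using E12 mD unfolding A_def D_def L_def by algebra
  with y1 \<open>r \<noteq> 0\<close> have "(1 + m) * C * D + (1 - r*y)\<^sup>2 * L = 0" by simp
  then have GC: "(A + D) * C = - ((1 - r*y)\<^sup>2 * L)"
    using mD by algebra
  have P1: "(1 + m*r) * D = - r * (1 - r*y) * K1"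
  proof -
    have "(1 + m*r) * D = D + r * A" by (simp add: mD[symmetric] algebra_simps)
    also have "\<dots> = - r * (1 - r*y) * K1" unfolding A_def D_def K1_def by algebra
    finally show ?thesis .
  qed
  have P2: "(m + y) * D = - y * (1 - r*y) * K2"
  proof -
    have "(m + y) * D = A + y * D" by (simp add: mD[symmetric] algebra_simps)
    also have "\<dots> = - y * (1 - r*y) * K2" unfolding A_def D_def K2_def by algebra
    finally show ?thesis .
  qed
  have D0: "D \<noteq> 0"
  proof
    assume "D = 0"
    then have "K1 = 0" "K2 = 0"
      using P1 P2 \<open>r \<noteq> 0\<close> \<open>y \<noteq> 0\<close> pi1 by auto
    then have "r = y" unfolding K1_def K2_def by linarith
    with \<open>K1 = 0\<close> have "(1 - r)\<^sup>2 = 0" unfolding K1_def by algebra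
    with r1 show False by simp
  qed
  have P3: "(m * (r + y) + (1 + m\<^sup>2) * (r*y)) * D\<^sup>2 = r * y * (1 - r*y) * W"
  proof -
    have "(m * (r + y) + (1 + m\<^sup>2) * (r*y)) * D\<^sup>2 = A * D * (r + y) + (D\<^sup>2 + A\<^sup>2) * (r*y)"
      by (simp add: mD[symmetric] algebra_simps power2_eq_square)
    also have "\<dots> = r * y * (1 - r*y) * W"
      unfolding A_def D_def W_def by algebra
    finally show ?thesis .
  qed
  define G where "G = A + D"
  \<comment> \<open>The third equation, multiplied by \<open>G * D\<^sup>2\<close>, has this expression as a factor; the identity is its factorisation.\<close>
  have key: "(4*(r*y) * G - (1 - r*y) * L\<^sup>2) * (K1 * K2) - (G + (1 - r) * (1 - y) * L) * W
      = - (L * K1 * K2 * ((1 - r) * (1 - y) * (1 - r*y)))"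
    unfolding G_def A_def D_def L_def K1_def K2_def W_def by algebra
  have "G * (C * L + 4*(r*y) * (1 - r*y)) = (1 - r*y) * (4*(r*y) * G - (1 - r*y) * L\<^sup>2)"
    using GC unfolding G_def by algebra
  moreover have "((1 + m*r) * (m + y)) * D\<^sup>2 = r * y * (1 - r*y)\<^sup>2 * (K1 * K2)"
    using P1 P2 by algebra
  moreover have "G * ((1 - r*y)\<^sup>2 - C * (1 - r) * (1 - y)) = (1 - r*y)\<^sup>2 * (G + (1 - r) * (1 - y) * L)"
    using GC unfolding G_def by algebra
  ultimately have "r * y * (1 - r*y)^3 * ((4*(r*y) * G - (1 - r*y) * L\<^sup>2) * (K1 * K2)
      - (G + (1 - r) * (1 - y) * L) * W) = 0"
    using T[folded L_def] P3 by algebra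
  then have "L * K1 * K2 = 0"
    using \<open>r \<noteq> 0\<close> \<open>y \<noteq> 0\<close> pi1 r1 y1 unfolding key by auto
  moreover have "K1 \<noteq> 0" "K2 \<noteq> 0"
    using P1 P2 D0 \<open>1 + m * r \<noteq> 0\<close> \<open>m + y \<noteq> 0\<close> by auto
  ultimately have "L = 0" by simp
  then have "(A + D) = 0" using GC \<open>C \<noteq> 0\<close> by simp
  then have "(1 + m) * D = 0" using mD by (simp add: algebra_simps)
  with D0 \<open>m \<noteq> -1\<close> show False by (simp add: add_eq_0_iff)
qed

text \<open>The equation for the second pair is \<open>pair_balance\<close> with the pairs exchanged and
\<open>\<mu> = 1 / m\<close>. The first alternative of the conclusion is the branch \<open>p = m\<close>, the second one its mirror
image under this exchange.\<close>

lemma asymmetric_invariants: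
  fixes a b c d \<tau> m :: real
  assumes ab: "(1 + \<tau> * a * b) * Sab = 1" and cd: "(1 + \<tau> * c * d) * Scd = 1"
    and ac: "(1 + \<tau> * a * c) * Sac = 1" and ad: "(1 + \<tau> * a * d) * Sad = 1"
    and bc: "(1 + \<tau> * b * c) * Sbc = 1" and bd: "(1 + \<tau> * b * d) * Sbd = 1"
    and weights: "a + b + m * (c + d) = 0"
    and ta: "b * Sab + m * (c * Sac + d * Sad) = t" and tb: "a * Sab + m * (c * Sbc + d * Sbd) = t"
    and tc: "a * Sac + b * Sbc + m * (d * Scd) = t" and td: "a * Sad + b * Sbd + m * (c * Scd) = t"
    and m: "m \<noteq> 0" "m \<noteq> -1"
    and nz: "a \<noteq> 0" "b \<noteq> 0" "c \<noteq> 0" "d \<noteq> 0" and neq: "a \<noteq> b" "c \<noteq> d" "c + d \<noteq> 0"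
  shows "\<tau> * (a * b) = m \<and> \<tau> * (c * d) * (m + 2) = -1 \<and> \<tau> * (c + d)\<^sup>2 * (m * (m + 2)) = -2 * (m + 1)
    \<or> \<tau> * (c * d) * m = 1 \<and> \<tau> * (a * b) * (1 + 2 * m) = - m \<and> \<tau> * (a + b)\<^sup>2 * (1 + 2 * m) = -2 * m * (m + 1)"
proof -
  define p where "p = \<tau> * a * b"
  define q where "q = \<tau> * c * d"
  define B where "B = \<tau> * (c + d)\<^sup>2"
  define r where "r = p / m"
  define y where "y = m * q"
  define C where "C = m * B"
  have p: "p = m * r" and q: "q = y / m" and B: "B = C / m"
    using m by (simp_all add: r_def y_def C_def)
  have AB: "\<tau> * (a + b)\<^sup>2 = m\<^sup>2 * B"
    using weights unfolding B_def by algebra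
  have E12: "(1 + m) * p * B * (1 - m * q) + (1 - p * q) * (1 - p * q - 2 * m * q * (1 + p)) = 0"
    by (rule pair_balance[OF ab ac ad bc bd weights neq(1) _ p_def q_def B_def])
      (use ta tb in simp)
  have E34: "(1 + 1/m) * q * (m\<^sup>2 * B) * (1 - 1/m * p) + (1 - q * p) * (1 - q * p - 2 * (1/m) * p * (1 + q)) = 0"
  proof (rule pair_balance[where a = c and b = d and c = a and d = b and \<tau> = \<tau>])
    show "c + d + 1 / m * (a + b) = 0"
      using weights m by (simp add: field_simps)
    have "m * (d * Scd + 1/m * (a * Sac + b * Sbc)) = m * (c * Scd + 1/m * (a * Sad + b * Sbd))"
      using tc td m by (simp add: field_simps)
    then show "d * Scd + 1/m * (a * Sac + b * Sbc) = c * Scd + 1/m * (a * Sad + b * Sbd)"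
      using m by simp
  qed (use neq cd ac ad bc bd AB p_def q_def in \<open>simp_all add: mult_ac\<close>)
  have T: "m * (B * (m - 2 * p - 2 * m\<^sup>2 * q + 3 * m * p * q) + 4 * p * q * (1 - p * q)) * ((1 + p) * (1 + q))
     = ((1 - p * q)\<^sup>2 - B * (m - p) * (1 - m * q)) * (p * (1 + q) + m\<^sup>2 * q * (1 + p))"
    and R: "((1 - p * q)\<^sup>2 - B * (m - p) * (1 - m * q)) * (Sac * Sbc * Sad * Sbd) = 1"
    using inertia_balance[OF ab cd ac ad bc bd weights ta tb tc td p_def q_def B_def refl] by auto
  \<comment> \<open>For \<open>\<tau> = 0\<close> all distances would be equal; the first equation then reads \<open>1 = 0\<close>.\<close>
  have "\<tau> \<noteq> 0"
  proof
    assume "\<tau> = 0"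
    then have "p = 0" "q = 0" by (simp_all add: p_def q_def)
    with E12 show False by simp
  qed
  then have nz': "p \<noteq> 0" "q \<noteq> 0" "B \<noteq> 0"
    using nz neq by (simp_all add: p_def q_def B_def)
  have pq: "p * q = r * y" using m unfolding p q by simp
  have Bpq: "B * (m - p) = C * (1 - r)"
    using m unfolding p B by (simp add: field_simps)
  have e12: "(1 + m) * r * C * (1 - y) + (1 - r*y) * (1 - r*y - 2*y - 2*m*(r*y)) = 0"
  proof -
    have "p * B = r * C" using m unfolding p B by simp
    moreover have "2 * m * q * (1 + p) = 2*y + 2*m*(r*y)" using m unfolding p q by (simp add: field_simps)
    moreover have "m * q = y" by (simp add: y_def)
    ultimately show ?thesis using E12 pq by (simp add: mult.assoc diff_diff_eq add.assoc)
  qed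
  have e34: "(1 + m) * y * C * (1 - r) + (1 - r*y) * (m * (1 - r*y - 2*r) - 2*(r*y)) = 0"
  proof -
    have "m * ((1 + 1/m) * q * (m\<^sup>2 * B) * (1 - 1/m * p)) = (1 + m) * y * C * (1 - r)"
      using m unfolding p q B by (simp add: field_simps power2_eq_square)
    moreover have "m * (1 - q * p - 2 * (1/m) * p * (1 + q)) = m * (1 - r*y - 2*r) - 2*(r*y)"
      using m unfolding p q by (simp add: field_simps)
    moreover have "m * ((1 + 1/m) * q * (m\<^sup>2 * B) * (1 - 1/m * p)) + (1 - q * p) * (m * (1 - q * p - 2 * (1/m) * p * (1 + q))) = 0"
      using arg_cong[OF E34, of "\<lambda>z. m * z"] by (simp only: distrib_left mult.left_commute mult_zero_right)
    ultimately show ?thesis using pq by (simp add: mult.commute)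
  qed
  have e1q: "m * (1 + q) = m + y" using m unfolding q by (simp add: field_simps)
  have t: "(C * (1 - 2*r - 2*y + 3*(r*y)) + 4*(r*y) * (1 - r*y)) * ((1 + m*r) * (m + y))
            = ((1 - r*y)\<^sup>2 - C * (1 - r) * (1 - y)) * (m * (r + y) + (1 + m\<^sup>2) * (r*y))"
  proof -
    have Z: "m * X * ((1 + p) * (1 + q)) = X * ((1 + m * r) * (m + y))" for X
      unfolding e1q[symmetric] p by (simp add: mult_ac)
    have "B * (m - 2 * p - 2 * m\<^sup>2 * q + 3 * m * p * q) = C * (1 - 2*r - 2*y + 3*(r*y))"
      using m unfolding p q B by (simp add: field_simps power2_eq_square)
    moreover have "p * (1 + q) + m\<^sup>2 * q * (1 + p) = m * (r + y) + (1 + m\<^sup>2) * (r*y)"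
      using m unfolding p q by (simp add: field_simps power2_eq_square)
    moreover have "m * q = y" by (simp add: y_def)
    ultimately show ?thesis using T[unfolded Z] pq Bpq by (simp add: mult.assoc)
  qed
  have Rne: "(1 - r*y)\<^sup>2 - C * (1 - r) * (1 - y) \<noteq> 0"
  proof -
    have "m * q = y" by (simp add: y_def)
    then show ?thesis using R pq Bpq by auto
  qed
  have "1 + m * r \<noteq> 0"
    using ab unfolding p[symmetric] p_def by auto
  moreover have "m + y \<noteq> 0"
    using cd m unfolding e1q[symmetric] q_def by auto
  ultimately have "r = 1 \<or> y = 1"
    using elimination_branches[OF e12 e34 t Rne m(2)] nz' m unfolding r_def y_def C_def by simp
  then show ?thesis
  proof
    assume r: "r = 1"
    have "1 - y \<noteq> 0" using Rne r by auto
    moreover have "(1 - y) * (m * (1 + y) + 2 * y) = 0"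
      using e34 unfolding r by algebra
    moreover have "(1 - y) * ((1 + m) * C + (1 - 3 * y - 2 * m * y)) = 0"
      using e12 unfolding r by algebra
    ultimately have 1: "m * (1 + y) + 2 * y = 0" and 2: "(1 + m) * C + (1 - 3 * y - 2 * m * y) = 0"
      by simp_all
    have "m * (q * (m + 2)) = m * (-1)"
      using 1 unfolding y_def by algebra
    then have 3: "q * (m + 2) = -1" using m by (metis mult_left_cancel)
    have "(1 + m) * (C * (m + 2)) = (1 + m) * (-2 * (m + 1))"
      using 2 3 unfolding y_def by algebra
    then have "C * (m + 2) = -2 * (m + 1)" using m by (metis add.commute add_eq_0_iff mult_left_cancel)
    with 3 r p show ?thesis
      unfolding C_def B_def q_def p_def by (simp add: mult_ac)
  next
    assume y: "y = 1"
    have "1 - r \<noteq> 0" using Rne y by auto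
    moreover have "(1 - r) * (-1 - r - 2 * m * r) = 0"
      using e12 unfolding y by algebra
    moreover have "(1 - r) * ((1 + m) * C + (m * (1 - 3 * r) - 2 * r)) = 0"
      using e34 unfolding y by algebra
    ultimately have 1: "-1 - r - 2 * m * r = 0" and 2: "(1 + m) * C + (m * (1 - 3 * r) - 2 * r) = 0"
      by simp_all
    have 3: "p * (1 + 2 * m) = - m"
      using 1 unfolding p by algebra
    have "(1 + m) * (C * (1 + 2 * m)) = (1 + m) * (-2 * (m + 1))"
      using 1 2 by algebra
    then have "C * (1 + 2 * m) = -2 * (m + 1)" using m by (metis add.commute add_eq_0_iff mult_left_cancel)
    then have "m\<^sup>2 * B * (1 + 2 * m) = -2 * m * (m + 1)"
      unfolding C_def by algebra
    with 3 y show ?thesis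
      unfolding AB p_def y_def q_def by (simp add: mult_ac)
  qed
qed

text \<open>In the first alternative \<open>\<tau> * (c - d)\<^sup>2 * (m * (m + 2)) = 2 * (m - 1)\<close>, in addition to
\<open>\<tau> * (c + d)\<^sup>2 * (m * (m + 2)) = -2 * (m + 1)\<close>. The product of the two left-hand sides is a
square, so \<open>m\<^sup>2 < 1\<close>, and the sign of \<open>\<tau>\<close> follows. The second alternative is treated in the same way
with \<open>a\<close> and \<open>b\<close>.\<close>

lemma asymmetric_sign_patterns:
  fixes a b c d \<tau> m :: real
  assumes "m \<noteq> 0" "c + d \<noteq> 0" "a + b \<noteq> 0" "a \<noteq> b" "c \<noteq> d"
    and "\<tau> * (a * b) = m \<and> \<tau> * (c * d) * (m + 2) = -1 \<and> \<tau> * (c + d)\<^sup>2 * (m * (m + 2)) = -2 * (m + 1)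
    \<or> \<tau> * (c * d) * m = 1 \<and> \<tau> * (a * b) * (1 + 2 * m) = - m \<and> \<tau> * (a + b)\<^sup>2 * (1 + 2 * m) = -2 * m * (m + 1)"
      (is "?X \<or> ?Y")
  shows "0 < m \<and> m < 1 \<and> a * b < 0 \<and> 0 < c * d \<or> 1 < m \<and> 0 < a * b \<and> c * d < 0
    \<or> m < 0 \<and> a * b < 0 \<and> c * d < 0"
proof -
  have right_neg_if: "z < 0" if "0 < w * z" "w < 0" for w z :: real
    using that by (simp add: zero_less_mult_iff)
  have right_pos_if: "0 < z" if "w * z < 0" "w < 0" for w z :: real
    using that by (simp add: mult_less_0_iff)
  have left_neg_if: "w < 0" if "w * z < 0" "0 < z" for w z :: real
    using that by (simp add: mult_less_0_iff)
  show ?thesis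
    using assms(6)
  proof
    assume ?X
    then have X: "\<tau> * (a * b) = m" "\<tau> * (c * d) * (m + 2) = -1"
        "\<tau> * (c + d)\<^sup>2 * (m * (m + 2)) = -2 * (m + 1)" by blast+
    then have "\<tau> \<noteq> 0" using \<open>m \<noteq> 0\<close> by auto
    have diff: "\<tau> * (c - d)\<^sup>2 * (m * (m + 2)) = 2 * (m - 1)"
      using X(2,3) by algebra
    have "m + 2 \<noteq> 0" using X by auto
    then have "0 < (\<tau> * (m * (m + 2)) * (c + d) * (c - d))\<^sup>2"
      using assms \<open>\<tau> \<noteq> 0\<close> by simp
    also have "\<dots> = 4 * (1 - m\<^sup>2)"
      using X(3) diff by algebra
    finally have "m\<^sup>2 < 1" by simp
    then have m1: "-1 < m" "m < 1" by (simp_all add: abs_square_less_1 abs_less_iff)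
    have "(\<tau> * m) * ((c + d)\<^sup>2 * (m + 2)) < 0"
      using X m1 by (simp add: mult_ac)
    moreover have "0 < (c + d)\<^sup>2 * (m + 2)" using m1 assms by simp
    ultimately have tm: "\<tau> * m < 0" by - (rule left_neg_if, auto)
    have "(\<tau> * m) * (a * b) = (\<tau> * (a * b)) * m" by (simp add: mult_ac)
    also have "\<dots> = m\<^sup>2" unfolding X(1) by (simp add: power2_eq_square)
    finally have "(\<tau> * m) * (a * b) = m\<^sup>2" .
    then have "0 < (\<tau> * m) * (a * b)" using assms by simp
    with tm have ab: "a * b < 0"
      by - (rule right_neg_if[of "\<tau> * m"], auto)
    have "(\<tau> * m) * ((c * d) * (m + 2)) = (\<tau> * (c * d) * (m + 2)) * m" by (simp add: mult_ac)
    then have cdm: "(\<tau> * m) * ((c * d) * (m + 2)) = - m" unfolding X(2) by simp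
    show ?thesis
    proof (cases "m < 0")
      case True
      with cdm have "0 < (\<tau> * m) * ((c * d) * (m + 2))" by simp
      with tm have "(c * d) * (m + 2) < 0" by - (rule right_neg_if, auto)
      with m1 have "c * d < 0" by - (rule left_neg_if[of "c * d" "m + 2"], auto)
      with True ab show ?thesis by simp
    next
      case False
      with \<open>m \<noteq> 0\<close> have "0 < m" by simp
      with cdm have "(\<tau> * m) * ((c * d) * (m + 2)) < 0" by simp
      with tm have "0 < (c * d) * (m + 2)" by - (rule right_pos_if, auto)
      with m1 have "0 < c * d" by (simp add: zero_less_mult_iff)
      with \<open>0 < m\<close> m1 ab show ?thesis by simp
    qed
  next
    assume ?Y
    then have Y: "\<tau> * (c * d) * m = 1" "\<tau> * (a * b) * (1 + 2 * m) = - m"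
        "\<tau> * (a + b)\<^sup>2 * (1 + 2 * m) = -2 * m * (m + 1)" by blast+
    then have "\<tau> \<noteq> 0" using \<open>m \<noteq> 0\<close> by auto
    have diff: "\<tau> * (a - b)\<^sup>2 * (1 + 2 * m) = 2 * m * (1 - m)"
      using Y(2,3) by algebra
    have "1 + 2 * m \<noteq> 0" using Y \<open>m \<noteq> 0\<close> by auto
    then have "0 < (\<tau> * (1 + 2 * m) * (a + b) * (a - b))\<^sup>2"
      using assms \<open>\<tau> \<noteq> 0\<close> by simp
    also have "\<dots> = (4 * m\<^sup>2) * (m\<^sup>2 - 1)"
      using Y(3) diff by algebra
    finally have "1 < m\<^sup>2" by (simp add: zero_less_mult_iff)
    then have "1 < m \<or> m < -1" using abs_square_le_1[of m] by auto
    then show ?thesis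
    proof
      assume m1: "1 < m"
      have "\<tau> * ((a + b)\<^sup>2 * (1 + 2 * m)) < 0"
      proof -
        have "0 < 2 * m * (m + 1)" using m1 by simp
        then show ?thesis using Y by (simp add: mult.assoc)
      qed
      moreover have "0 < (a + b)\<^sup>2 * (1 + 2 * m)" using m1 assms by simp
      ultimately have t: "\<tau> < 0" by - (rule left_neg_if, auto)
      have "0 < \<tau> * (c * d)" using Y m1 by (metis zero_less_mult_pos2 zero_less_one less_trans)
      moreover have "\<tau> * (a * b) < 0"
      proof -
        have "\<tau> * (a * b) * (1 + 2 * m) < 0" using Y m1 by simp
        with m1 show ?thesis by - (rule left_neg_if[of _ "1 + 2 * m"], auto)
      qed
      ultimately show ?thesis using t m1 by (simp add: zero_less_mult_iff mult_less_0_iff)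
    next
      assume m1: "m < -1"
      have "\<tau> * ((a + b)\<^sup>2 * (- (1 + 2 * m))) > 0"
      proof -
        have "0 < 2 * m * (m + 1)" using m1 by (simp add: mult_neg_neg)
        moreover have "\<tau> * ((a + b)\<^sup>2 * (- (1 + 2 * m))) = - (\<tau> * (a + b)\<^sup>2 * (1 + 2 * m))" by algebra
        ultimately show ?thesis using Y by simp
      qed
      moreover have "0 < (a + b)\<^sup>2 * (- (1 + 2 * m))" using m1 assms by simp
      ultimately have t: "0 < \<tau>" using zero_less_mult_pos2 by blast
      have "\<tau> * (c * d) < 0"
      proof -
        have "0 < \<tau> * (c * d) * m" using Y by simp
        with m1 show ?thesis by - (rule right_neg_if[of m], simp_all add: mult.commute)
      qed
      moreover have "\<tau> * (a * b) < 0"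
      proof -
        have "0 < \<tau> * (a * b) * (1 + 2 * m)" using Y m1 by simp
        with m1 show ?thesis by - (rule right_neg_if[of "1 + 2 * m"], simp_all add: mult.commute)
      qed
      ultimately show ?thesis using t m1 by (simp add: mult_less_0_iff)
    qed
  qed
qed

section \<open>Asymmetric relative equilibria\<close>

text \<open>Asymmetry supplies exactly the nondegeneracy conditions of the elimination: \<open>u 1 = u 2\<close> or
\<open>u 3 = u 4\<close> would give a kite, and \<open>u 3 + u 4 = 0\<close>, which implies \<open>u 1 + u 2 = 0\<close>, an isosceles
trapezoid.\<close>

lemma asymmetric_area_signs:
  fixes m :: real and \<Gamma> :: "4 \<Rightarrow> real" and x :: "4 \<Rightarrow> real ^ 2"
  assumes m: "m \<noteq> 0" "m \<noteq> -1"
    and \<Gamma>: "\<Gamma> 1 = 1" "\<Gamma> 2 = 1" "\<Gamma> 3 = m" "\<Gamma> 4 = m"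
    and eq: "relative_equilibrium \<Gamma> x" and planar: "strictly_planar x" and "asymmetric x"
  obtains \<Delta> where "affine_dependency x \<Delta>" "\<And>i. \<Delta> i \<noteq> 0"
    and "\<And>c. affine_dependency x c \<Longrightarrow> \<exists>k. \<forall>i. c i = k * \<Delta> i"
    and "0 < m \<and> m < 1 \<and> \<Delta> 1 * \<Delta> 2 < 0 \<and> 0 < \<Delta> 3 * \<Delta> 4
      \<or> 1 < m \<and> 0 < \<Delta> 1 * \<Delta> 2 \<and> \<Delta> 3 * \<Delta> 4 < 0
      \<or> m < 0 \<and> \<Delta> 1 * \<Delta> 2 < 0 \<and> \<Delta> 3 * \<Delta> 4 < 0"
proof -
  have "sum \<Gamma> UNIV = 2 * (1 + m)" unfolding sum_4 \<Gamma> by simp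
  then have "sum \<Gamma> UNIV \<noteq> 0" using m by (simp add: add_eq_0_iff)
  then obtain \<Delta> w \<sigma> where \<Delta>: "affine_dependency x \<Delta>" "\<And>i. \<Delta> i \<noteq> 0" "w \<noteq> 0"
    and spans: "\<And>c. affine_dependency x c \<Longrightarrow> \<exists>k. \<forall>i. c i = k * \<Delta> i"
    and dists: "\<And>i j. i \<noteq> j \<Longrightarrow> (dist (x i) (x j))\<^sup>2 * (w + \<sigma> * (\<Delta> i / \<Gamma> i) * (\<Delta> j / \<Gamma> j)) = 1"
    using vortex_parametrisation[OF eq planar] by blast
  have "inj x" using eq by (simp add: relative_equilibrium_def)
  have neq: "x i \<noteq> x j" if "i \<noteq> j" for i j using that \<open>inj x\<close> by (simp add: inj_eq)
  have asym: "\<not> has_line_of_symmetry x" using \<open>asymmetric x\<close> by (simp add: asymmetric_def)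
  define u where "u i = \<Delta> i / \<Gamma> i" for i
  have u: "u 1 = \<Delta> 1" "u 2 = \<Delta> 2" "\<Delta> 3 = m * u 3" "\<Delta> 4 = m * u 4"
    using m by (simp_all add: u_def \<Gamma>)
  have unz: "u i \<noteq> 0" for i using \<Delta>(2) eq by (simp add: u_def relative_equilibrium_def)
  have same_dist: "dist (x i) (x j) = dist (x k) (x l)" if "i \<noteq> j" "k \<noteq> l" "u i * u j = u k * u l" for i j k l
  proof -
    define D where "D = w + \<sigma> * (u i * u j)"
    have "(dist (x i) (x j))\<^sup>2 * D = 1" "(dist (x k) (x l))\<^sup>2 * D = 1"
      using dists[OF that(1), folded u_def] dists[OF that(2), folded u_def] that(3)
      by (simp_all add: D_def mult.assoc)
    then have "(dist (x i) (x j))\<^sup>2 = (dist (x k) (x l))\<^sup>2"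
      by (metis mult_cancel_right mult_zero_right zero_neq_one)
    then show ?thesis by simp
  qed
  have weights: "u 1 + u 2 + m * (u 3 + u 4) = 0"
    using \<Delta>(1) by (simp add: affine_dependency_iff u distrib_left add.assoc)
  have "u 1 \<noteq> u 2"
  proof
    assume "u 1 = u 2"
    then have "has_line_of_symmetry x"
      by (intro kite_symmetric[of 1 2 3 4] UNIV_4 neq same_dist) simp_all
    with asym show False ..
  qed
  moreover have "u 3 \<noteq> u 4"
  proof
    assume "u 3 = u 4"
    then have "has_line_of_symmetry x"
      by (intro kite_symmetric[of 3 4 1 2] neq same_dist) (use UNIV_4 in auto)
    with asym show False ..
  qed
  moreover have "u 3 + u 4 \<noteq> 0"
  proof
    assume 0: "u 3 + u 4 = 0"
    then have u2: "u 2 = - u 1" "u 4 = - u 3" using weights by simp_all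
    have "\<Delta> 1 *\<^sub>R x 1 + \<Delta> 2 *\<^sub>R x 2 + \<Delta> 3 *\<^sub>R x 3 + \<Delta> 4 *\<^sub>R x 4 = 0"
      using \<Delta>(1) unfolding affine_dependency_def sum_4 by simp
    moreover have "\<Delta> 1 = u 1" "\<Delta> 2 = - u 1" "\<Delta> 3 = m * u 3" "\<Delta> 4 = - (m * u 3)"
      using u2 u by simp_all
    ultimately have "u 1 *\<^sub>R (x 1 - x 2) + (m * u 3) *\<^sub>R (x 3 - x 4) = 0"
      by (simp only: scaleR_diff_right scaleR_minus_left) (simp add: algebra_simps)
    then have "(m * u 3) *\<^sub>R (x 3 - x 4) = (- u 1) *\<^sub>R (x 1 - x 2)"
      by (simp add: eq_neg_iff_add_eq_0 add.commute)
    then have "(1 / (m * u 3)) *\<^sub>R ((m * u 3) *\<^sub>R (x 3 - x 4)) = (1 / (m * u 3)) *\<^sub>R ((- u 1) *\<^sub>R (x 1 - x 2))"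
      by simp
    then have parallel: "x 3 - x 4 = (- u 1 / (m * u 3)) *\<^sub>R (x 1 - x 2)"
      using m unz by simp
    have "has_line_of_symmetry x"
      by (intro trapezoid_symmetric[OF UNIV_4 _ parallel] neq same_dist) (use u2 in simp_all)
    with asym show False ..
  qed
  moreover define \<tau> where "\<tau> = \<sigma> / w"
  define S where "S i j = w * (dist (x i) (x j))\<^sup>2" for i j
  have S: "(1 + \<tau> * u i * u j) * S i j = 1" if "i \<noteq> j" for i j
    using dists[OF that] \<Delta>(3) by (simp add: \<tau>_def S_def u_def field_simps)
  define t where "t = w * (\<Sum>i\<in>UNIV. \<Delta> i * (x i \<bullet> x i))"
  have t: "\<Delta> 1 * S i 1 + \<Delta> 2 * S i 2 + \<Delta> 3 * S i 3 + \<Delta> 4 * S i 4 = t" for i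
  proof -
    have "w * (\<Sum>j\<in>UNIV. \<Delta> j * (dist (x i) (x j))\<^sup>2) = t"
      unfolding affine_dependency_moment[OF \<Delta>(1)] t_def ..
    then show ?thesis unfolding sum_4 by (simp add: S_def algebra_simps)
  qed
  have S0: "S i i = 0" "S i j = S j i" for i j by (simp_all add: S_def dist_commute)
  have prods: "\<tau> * (u 1 * u 2) = m \<and> \<tau> * (u 3 * u 4) * (m + 2) = -1 \<and> \<tau> * (u 3 + u 4)\<^sup>2 * (m * (m + 2)) = -2 * (m + 1)
    \<or> \<tau> * (u 3 * u 4) * m = 1 \<and> \<tau> * (u 1 * u 2) * (1 + 2 * m) = - m
      \<and> \<tau> * (u 1 + u 2)\<^sup>2 * (1 + 2 * m) = -2 * m * (m + 1)"
  proof (rule asymmetric_invariants[OF S S S S S S weights _ _ _ _ m])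
    show "u 2 * S 1 2 + m * (u 3 * S 1 3 + u 4 * S 1 4) = t"
      using t[of 1] by (simp add: S0 u algebra_simps)
    show "u 1 * S 1 2 + m * (u 3 * S 2 3 + u 4 * S 2 4) = t"
      using t[of 2] by (simp add: S0 S0(2)[of 2 1] u algebra_simps)
    show "u 1 * S 1 3 + u 2 * S 2 3 + m * (u 4 * S 3 4) = t"
      using t[of 3] by (simp add: S0 S0(2)[of 3 1] S0(2)[of 3 2] u algebra_simps)
    show "u 1 * S 1 4 + u 2 * S 2 4 + m * (u 3 * S 3 4) = t"
      using t[of 4] by (simp add: S0 S0(2)[of 4 1] S0(2)[of 4 2] S0(2)[of 4 3] u algebra_simps)
  qed (use unz calculation in simp_all)
  have "u 1 + u 2 \<noteq> 0" using weights \<open>u 3 + u 4 \<noteq> 0\<close> m by auto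
  from asymmetric_sign_patterns[OF m(1) \<open>u 3 + u 4 \<noteq> 0\<close> this \<open>u 1 \<noteq> u 2\<close> \<open>u 3 \<noteq> u 4\<close> prods]
  have "0 < m \<and> m < 1 \<and> u 1 * u 2 < 0 \<and> 0 < u 3 * u 4 \<or> 1 < m \<and> 0 < u 1 * u 2 \<and> u 3 * u 4 < 0
    \<or> m < 0 \<and> u 1 * u 2 < 0 \<and> u 3 * u 4 < 0" .
  moreover have "\<Delta> 1 * \<Delta> 2 = u 1 * u 2" "\<Delta> 3 * \<Delta> 4 = m\<^sup>2 * (u 3 * u 4)"
    by (simp_all add: u power2_eq_square)
  moreover have "0 < m\<^sup>2" using m by simp
  ultimately show ?thesis
    using that[OF \<Delta>(1,2) spans] by (simp add: mult_less_0_iff[of "m\<^sup>2"] zero_less_mult_iff[of "m\<^sup>2"])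
qed

theorem theorem6p2:
  fixes m :: real and \<Gamma> :: "4 \<Rightarrow> real" and x :: "4 \<Rightarrow> real ^ 2"
  assumes "m \<noteq> 0" and "m \<noteq> -1"
    and "\<Gamma> 1 = 1" and "\<Gamma> 2 = 1" and "\<Gamma> 3 = m" and "\<Gamma> 4 = m"
    and "relative_equilibrium \<Gamma> x"
    and "strictly_planar x"
  shows "(m > 0 \<longrightarrow>
            (convex_config x \<longrightarrow> has_line_of_symmetry x) \<and>
            (asymmetric x \<longrightarrow>
               concave_config x \<and>
               (m < 1 \<longrightarrow> on_exterior_triangle x 3 \<and> on_exterior_triangle x 4) \<and>
               (m > 1 \<longrightarrow> on_exterior_triangle x 1 \<and> on_exterior_triangle x 2)) \<and>
            (m = 1 \<longrightarrow> has_line_of_symmetry x)) \<and>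
         (m < 0 \<longrightarrow>
            (concave_config x \<longrightarrow> has_line_of_symmetry x) \<and>
            (asymmetric x \<longrightarrow>
               convex_config x \<and> adjacent x 1 2 \<and> adjacent x 3 4))"
proof (cases "asymmetric x")
  case False
  then show ?thesis by (simp add: asymmetric_def)
next
  case True
  obtain \<Delta> where dep: "affine_dependency x \<Delta>" and nz: "\<And>i. \<Delta> i \<noteq> 0"
    and spans: "\<And>c. affine_dependency x c \<Longrightarrow> \<exists>k. \<forall>i. c i = k * \<Delta> i"
    and signs: "0 < m \<and> m < 1 \<and> \<Delta> 1 * \<Delta> 2 < 0 \<and> 0 < \<Delta> 3 * \<Delta> 4
      \<or> 1 < m \<and> 0 < \<Delta> 1 * \<Delta> 2 \<and> \<Delta> 3 * \<Delta> 4 < 0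
      \<or> m < 0 \<and> \<Delta> 1 * \<Delta> 2 < 0 \<and> \<Delta> 3 * \<Delta> 4 < 0"
    using asymmetric_area_signs[OF assms True] by blast
  have "inj x" using assms(7) by (simp add: relative_equilibrium_def)
  have no3: "no_three_collinear x"
    using no_three_collinear_if_all_nonzero[OF \<open>inj x\<close> spans nz] .
  have interior: "interior_vortex x l" if "\<forall>n. n \<noteq> l \<longrightarrow> \<Delta> n * \<Delta> l < 0" for l
    using interior_vortexI[OF dep no3] that by blast
  have not_both: "\<not> (interior_vortex x l \<and> convex_config x)" for l
    unfolding interior_vortex_def convex_config_def using interior_subset by blast
  consider (low) "0 < m" "m < 1" "\<Delta> 1 * \<Delta> 2 < 0" "0 < \<Delta> 3 * \<Delta> 4"
    | (high) "1 < m" "0 < \<Delta> 1 * \<Delta> 2" "\<Delta> 3 * \<Delta> 4 < 0"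
    | (neg) "m < 0" "\<Delta> 1 * \<Delta> 2 < 0" "\<Delta> 3 * \<Delta> 4 < 0"
    using signs by blast
  then show ?thesis
  proof cases
    case low
    \<comment> \<open>Three coefficients agree in sign, among them those of the vortices \<open>3\<close> and \<open>4\<close>.\<close>
    then have "interior_vortex x 1 \<or> interior_vortex x 2"
      using interior[of 1] interior[of 2]
      unfolding forall_4 by (auto simp: mult_less_0_iff zero_less_mult_iff)
    then obtain l where l: "interior_vortex x l" "l = 1 \<or> l = 2" by blast
    then have "on_exterior_triangle x 3" "on_exterior_triangle x 4"
      unfolding on_exterior_triangle_def by auto
    then show ?thesis
      using l low no3 not_both[of l] by (auto simp: concave_config_def)
  next
    case high
    then have "interior_vortex x 3 \<or> interior_vortex x 4"
      using interior[of 3] interior[of 4]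
      unfolding forall_4 by (auto simp: mult_less_0_iff zero_less_mult_iff)
    then obtain l where l: "interior_vortex x l" "l = 3 \<or> l = 4" by blast
    then have "on_exterior_triangle x 1" "on_exterior_triangle x 2"
      unfolding on_exterior_triangle_def by auto
    then show ?thesis
      using l high no3 not_both[of l] by (auto simp: concave_config_def)
  next
    case neg
    have "\<forall>l. \<exists>n. n \<noteq> l \<and> 0 < \<Delta> n * \<Delta> l"
      using neg unfolding forall_4
      by (auto simp: mult_less_0_iff zero_less_mult_iff intro: exI[of _ 1] exI[of _ 2] exI[of _ 3] exI[of _ 4])
    then have "convex_config x"
      by (intro convex_configI[OF spans no3]) auto
    moreover have "adjacent x 1 2"
      by (rule adjacentI[OF spans \<open>inj x\<close> UNIV_4]) (use neg in simp_all)
    moreover have "adjacent x 3 4"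
      by (rule adjacentI[OF spans \<open>inj x\<close>, where i = 3 and j = 4 and k = 1 and l = 2]) (use neg UNIV_4 in auto)
    ultimately show ?thesis
      using neg not_both by (auto simp: concave_config_def)
  qed
qed

end
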